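(* Let $G=(V,E)$ be a geographic network with set of sites $K\subseteq V$. Let $s\in K$ be any site, and let $v,w\in V$ be any vertices such that a shortest path from $s$ to $v$ goes through $w$. If there exist distinct sites $p,q\in K$ such that $$d(w,s)>\tfrac12\bigl(d(w,p)+d(w,q)+d(p,q)\bigr),$$ then $s$ cannot be part of a nearest round-trip pair to $v$; that is, there is no site $t\in K$, $t\neq s$, such that $(s,t)$ minimizes the round-trip distance $D_P(v,(\cdot,\cdot))$ from $v$ among all pairs of distinct sites of $K$.
   Context: A geographic network $G=(V,E)$ is a finite undirected graph, with edges being unordered pairs of distinct vertices, together with a weight function assigning a non-negative real number to each edge. It is assumed that any two vertices are joined by a path. For vertices $v,w$, $d(v,w)$ denotes the length (total weight) of a shortest (minimum weight) path between $v$ and $w$. A subset $K\subseteq V$ of vertices is designated as the set of sites. For a vertex $v$ and a pair of distinct sites $(s,t)$, the (two-site) round-trip distance is $D_P(v,(s,t))=d(v,s)+d(v,t)+d(s,t)$. *)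

theory Defs
  imports Complex_Main
begin

text \<open>Paths are vertex lists without repetition; the one-vertex list is the trivial path.\<close>

definition is_path :: "'a set \<Rightarrow> 'a set set \<Rightarrow> 'a \<Rightarrow> 'a \<Rightarrow> 'a list \<Rightarrow> bool" where
  "is_path V E u v xs \<longleftrightarrow>
     xs \<noteq> [] \<and> hd xs = u \<and> last xs = v \<and> set xs \<subseteq> V \<and> distinct xs \<and>
     successively (\<lambda>x y. {x, y} \<in> E) xs"

definition path_length :: "('a set \<Rightarrow> real) \<Rightarrow> 'a list \<Rightarrow> real" where
  "path_length wt xs = (\<Sum>(x, y)\<leftarrow>zip xs (tl xs). wt {x, y})"

definition shortest_path ::
    "'a set \<Rightarrow> 'a set set \<Rightarrow> ('a set \<Rightarrow> real) \<Rightarrow> 'a \<Rightarrow> 'a \<Rightarrow> 'a list \<Rightarrow> bool" where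
  "shortest_path V E wt u v xs \<longleftrightarrow> is_arg_min (path_length wt) (is_path V E u v) xs"

locale geographic_network =
  fixes V :: "'a set" and E :: "'a set set" and wt :: "'a set \<Rightarrow> real"
  assumes finite_V: "finite V"
    and edges: "E \<subseteq> {{x, y} | x y. x \<in> V \<and> y \<in> V \<and> x \<noteq> y}"
    and wt_nonneg: "\<And>e. e \<in> E \<Longrightarrow> 0 \<le> wt e"
    and connected: "\<And>u v. u \<in> V \<Longrightarrow> v \<in> V \<Longrightarrow> \<exists>xs. is_path V E u v xs"

text \<open>In a geographic network, the set under \<open>Min\<close> is finite and nonempty whenever
  \<open>u\<close> and \<open>v\<close> are vertices (see the lemmas below).\<close>

definition net_dist :: "'a set \<Rightarrow> 'a set set \<Rightarrow> ('a set \<Rightarrow> real) \<Rightarrow> 'a \<Rightarrow> 'a \<Rightarrow> real" where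
  "net_dist V E wt u v = Min (path_length wt ` {xs. is_path V E u v xs})"

definition round_trip_dist ::
    "'a set \<Rightarrow> 'a set set \<Rightarrow> ('a set \<Rightarrow> real) \<Rightarrow> 'a \<Rightarrow> 'a \<times> 'a \<Rightarrow> real" where
  "round_trip_dist V E wt v = (\<lambda>(s, t).
     net_dist V E wt v s + net_dist V E wt v t + net_dist V E wt s t)"

definition nearest_round_trip_pair ::
    "'a set \<Rightarrow> 'a set set \<Rightarrow> ('a set \<Rightarrow> real) \<Rightarrow> 'a set \<Rightarrow> 'a \<Rightarrow> 'a \<times> 'a \<Rightarrow> bool" where
  "nearest_round_trip_pair V E wt K v st \<longleftrightarrow>
     is_arg_min (round_trip_dist V E wt v) (\<lambda>(p, q). p \<in> K \<and> q \<in> K \<and> p \<noteq> q) st"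

context geographic_network
begin

lemma finite_paths: "finite {xs. is_path V E u v xs}"
proof (rule finite_subset)
  show "{xs. is_path V E u v xs} \<subseteq> {xs. set xs \<subseteq> V \<and> length xs \<le> card V}"
    using finite_V by (auto simp: is_path_def distinct_card[symmetric] intro: card_mono)
  show "finite {xs. set xs \<subseteq> V \<and> length xs \<le> card V}"
    using finite_V by (rule finite_lists_length_le)
qed

lemma shortest_path_iff:
  "shortest_path V E wt u v xs \<longleftrightarrow>
     is_path V E u v xs \<and> path_length wt xs = net_dist V E wt u v"
proof -
  have "finite (path_length wt ` {ys. is_path V E u v ys})"
    using finite_paths by blast
  then show ?thesis
    unfolding shortest_path_def is_arg_min_linorder net_dist_def
    by (auto intro!: Min_eqI[symmetric])
qed

lemma shortest_path_exists:
  assumes "u \<in> V" "v \<in> V"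
  shows "\<exists>xs. shortest_path V E wt u v xs"
proof -
  have "Min (path_length wt ` {xs. is_path V E u v xs}) \<in> path_length wt ` {xs. is_path V E u v xs}"
    using finite_paths connected[OF assms] by (intro Min_in) auto
  then show ?thesis
    by (auto simp: shortest_path_iff net_dist_def)
qed

end

end

theory Submission
  imports Defs
begin

text \<open>Write \<open>d\<close> for the network distance and \<open>D\<close> for the round-trip distance. Since
  \<open>d v s = d v w + d w s\<close>, the detour through \<open>w\<close> gives
  \<open>D v (p, q) \<le> 2 * d v w + d w p + d w q + d p q < 2 * d v w + 2 * d w s = 2 * d v s\<close>,
  while \<open>2 * d v s \<le> D v (s, t)\<close> for every \<open>t\<close> by the triangle inequality.\<close>

lemma path_length_Nil [simp]: "path_length wt [] = 0"
  and path_length_single [simp]: "path_length wt [x] = 0"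
  and path_length_Cons_Cons [simp]:
    "path_length wt (x # y # xs) = wt {x, y} + path_length wt (y # xs)"
  by (simp_all add: path_length_def)

text \<open>The cut vertex \<open>y\<close> is kept in both pieces, so every edge is counted exactly
  once.\<close>

lemma path_length_append:
  "path_length wt (xs @ y # ys) = path_length wt (xs @ [y]) + path_length wt (y # ys)"
  by (induction xs rule: induct_list012) auto

lemma path_length_rev: "path_length wt (rev xs) = path_length wt xs"
proof (induction xs rule: induct_list012)
  case (3 x y zs)
  then show ?case
    using path_length_append[of wt "rev zs" y "[x]"] by (simp add: insert_commute)
qed simp_all

lemma is_path_rev: "is_path V E u v xs \<Longrightarrow> is_path V E v u (rev xs)"
  by (auto simp: is_path_def hd_rev last_rev insert_commute)

lemma is_path_splitD:
  assumes "is_path V E u v (xs @ y # ys)"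
  shows "is_path V E u y (xs @ [y])" and "is_path V E y v (y # ys)"
  using assms by (auto simp: is_path_def successively_append_iff hd_append split: if_splits)

context geographic_network
begin

lemma net_dist_le: "is_path V E u v xs \<Longrightarrow> net_dist V E wt u v \<le> path_length wt xs"
  unfolding net_dist_def using finite_paths by (intro Min_le) auto

text \<open>Weights are known to be nonnegative only on \<open>E\<close>; the path hypothesis places
  every consecutive pair there.\<close>

lemma path_length_nonneg: "is_path V E u v xs \<Longrightarrow> 0 \<le> path_length wt xs"
proof (induction xs arbitrary: u rule: induct_list012)
  case (3 x y zs)
  have "{x, y} \<in> E" and "is_path V E y v (y # zs)"
    using "3.prems" by (auto simp: is_path_def)
  then show ?case
    using "3.IH"(2) wt_nonneg by fastforce
qed auto

lemma net_dist_attained: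
  assumes "u \<in> V" "v \<in> V"
  obtains xs where "is_path V E u v xs" "path_length wt xs = net_dist V E wt u v"
  using shortest_path_exists[OF assms] by (auto simp: shortest_path_iff)

lemma net_dist_commute:
  assumes "u \<in> V" "v \<in> V"
  shows "net_dist V E wt u v = net_dist V E wt v u"
proof -
  \<comment> \<open>Reversing a shortest path bounds the distance in the opposite direction;
    applying this both ways gives equality.\<close>
  have le: "net_dist V E wt y x \<le> net_dist V E wt x y" if xy: "x \<in> V" "y \<in> V" for x y
  proof -
    obtain xs where "is_path V E x y xs" "path_length wt xs = net_dist V E wt x y"
      using net_dist_attained[OF xy] .
    then show ?thesis
      using net_dist_le[OF is_path_rev, of x y xs] by (simp add: path_length_rev)
  qed
  show ?thesis
    using le[OF assms] le[OF assms(2,1)] by (rule antisym[rotated])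
qed

text \<open>Paths have no repeated vertices, so prepending \<open>u\<close> to a shortest path from \<open>x\<close>
  that already visits \<open>u\<close> is not allowed; in that case its final segment from \<open>u\<close> is used.\<close>

lemma net_dist_edge:
  assumes "{u, x} \<in> E" "u \<in> V" "x \<in> V" "v \<in> V"
  shows "net_dist V E wt u v \<le> wt {u, x} + net_dist V E wt x v"
proof -
  obtain xs where xs: "is_path V E x v xs" "path_length wt xs = net_dist V E wt x v"
    using net_dist_attained[OF assms(3,4)] .
  show ?thesis
  proof (cases "u \<in> set xs")
    case True
    then obtain as bs where split: "xs = as @ u # bs"
      by (meson split_list)
    note segments = is_path_splitD[OF xs(1)[unfolded split]]
    have "net_dist V E wt u v \<le> path_length wt (u # bs)"
      using net_dist_le[OF segments(2)] .
    \<comment> \<open>The discarded initial segment and the edge \<open>{u, x}\<close> both have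
      nonnegative length, so the final segment alone satisfies the bound.\<close>
    moreover have "0 \<le> path_length wt (as @ [u])"
      using path_length_nonneg[OF segments(1)] .
    ultimately show ?thesis
      using xs(2) split path_length_append[of wt as u bs] wt_nonneg[OF assms(1)] by simp
  next
    case False
    obtain ys where ys: "xs = x # ys"
      using xs(1) by (cases xs) (auto simp: is_path_def)
    have "is_path V E u v (u # xs)"
      using xs(1) ys False assms by (auto simp: is_path_def)
    from net_dist_le[OF this] show ?thesis
      using xs(2) ys by simp
  qed
qed

text \<open>Joining two paths may repeat vertices, so they are not concatenated: the first path is
  peeled off edge by edge with \<open>net_dist_edge\<close>.\<close>

lemma net_dist_le_path_length_plus:
  assumes "is_path V E u x xs" "v \<in> V"
  shows "net_dist V E wt u v \<le> path_length wt xs + net_dist V E wt x v"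
  using assms(1)
proof (induction xs arbitrary: u rule: induct_list012)
  case (3 a b zs)
  have "{a, b} \<in> E" "a \<in> V" "b \<in> V" "u = a" and "is_path V E b x (b # zs)"
    using "3.prems" by (auto simp: is_path_def)
  then show ?case
    using "3.IH"(2) net_dist_edge[of a b v] assms(2) by fastforce
qed (auto simp: is_path_def)

lemma net_dist_triangle:
  assumes "u \<in> V" "x \<in> V" "v \<in> V"
  shows "net_dist V E wt u v \<le> net_dist V E wt u x + net_dist V E wt x v"
proof -
  obtain xs where "is_path V E u x xs" "path_length wt xs = net_dist V E wt u x"
    using net_dist_attained[OF assms(1,2)] .
  then show ?thesis
    using net_dist_le_path_length_plus[OF _ assms(3)] by metis
qed

text \<open>Cutting the path at \<open>x\<close> yields two paths whose lengths add up to the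
  distance, and each bounds the corresponding distance from above.\<close>

lemma net_dist_via_shortest_path:
  assumes "shortest_path V E wt u v xs" "x \<in> set xs"
  shows "net_dist V E wt u x + net_dist V E wt x v \<le> net_dist V E wt u v"
proof -
  obtain as bs where split: "xs = as @ x # bs"
    using assms(2) by (meson split_list)
  have xs: "is_path V E u v (as @ x # bs)" "path_length wt xs = net_dist V E wt u v"
    using assms(1) split by (auto simp: shortest_path_iff)
  show ?thesis
    using net_dist_le[OF is_path_splitD(1)[OF xs(1)]] net_dist_le[OF is_path_splitD(2)[OF xs(1)]]
      xs(2) split path_length_append[of wt as x bs] by simp
qed

end

theorem lemma4:
  fixes V K :: "'a set" and E :: "'a set set" and wt :: "'a set \<Rightarrow> real"
    and s v w :: 'a
  assumes "geographic_network V E wt"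
    and "K \<subseteq> V"
    and "s \<in> K" and "v \<in> V" and "w \<in> V"
    and "\<exists>xs. shortest_path V E wt s v xs \<and> w \<in> set xs"
    and "\<exists>p\<in>K. \<exists>q\<in>K. p \<noteq> q \<and>
           net_dist V E wt w s >
             1/2 * (net_dist V E wt w p + net_dist V E wt w q + net_dist V E wt p q)"
  shows "\<not> (\<exists>t\<in>K. t \<noteq> s \<and> nearest_round_trip_pair V E wt K v (s, t))"
proof
  interpret geographic_network V E wt by fact
  let ?d = "net_dist V E wt"
  assume "\<exists>t\<in>K. t \<noteq> s \<and> nearest_round_trip_pair V E wt K v (s, t)"
  then obtain t where t: "t \<in> K" "nearest_round_trip_pair V E wt K v (s, t)"
    by blast
  obtain p q where pq: "p \<in> K" "q \<in> K" "p \<noteq> q" "?d w s > 1/2 * (?d w p + ?d w q + ?d p q)"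
    using assms(7) by blast
  have V: "s \<in> V" "t \<in> V" "p \<in> V" "q \<in> V"
    using assms(2,3) t(1) pq(1,2) by auto
  have "?d s w + ?d w v \<le> ?d s v"
    using assms(6) net_dist_via_shortest_path by blast
  \<comment> \<open>The given path starts at \<open>s\<close>, whereas round trips are measured from
    \<open>v\<close>; symmetry turns it around.\<close>
  then have "?d v w + ?d w s \<le> ?d v s"
    using net_dist_commute[of s w] net_dist_commute[of s v] net_dist_commute[of w v] assms(4,5) V(1)
    by simp
  moreover have "?d v p \<le> ?d v w + ?d w p" "?d v q \<le> ?d v w + ?d w q"
    using net_dist_triangle assms(4,5) V by blast+
  \<comment> \<open>Adding \<open>?d v s\<close> on both sides bounds the round trip through
    \<open>s\<close> and \<open>t\<close> below by twice \<open>?d v s\<close>.\<close>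
  moreover have "?d v s \<le> ?d v t + ?d s t"
    using net_dist_triangle[of v t s] net_dist_commute[of t s] assms(4) V by simp
  ultimately have "round_trip_dist V E wt v (p, q) < round_trip_dist V E wt v (s, t)"
    using pq(4) by (simp add: round_trip_dist_def)
  with t(2) pq(1-3) show False
    by (auto simp: nearest_round_trip_pair_def is_arg_min_def)
qed

end
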